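(* Let $(X,T,A)$ be a soft $T_{0U}$ topological space. Then the following statements are equivalent: (a) $(X,T,A)$ is a soft $T_{(0,1^k)}$ space. (b) For each $x,y\in X$ with $x\not\approx y$, there are soft open sets $(G,A)$ and $(H,A)$ such that $x\in(G,A)$, $y\in(H,A)$, $x\in(H,A)^c$ and $y\in(G,A)^c$. (c) For each $x\in X$, the soft set $(F_{\dot x},A)$ over $X$ defined by $F_{\dot x}(a)=[x]$ for all $a\in A$, where $[x]=\{y\in X: y\approx x\}$, is soft closed in $X$.
   Context: A soft set over a set $X$ with parameter set $A$ is a pair $(F,A)$ with $F:A\to\mathcal P(X)$; $SS(X)_A$ is the set of all of them. $0_A$ and $1_A$ denote the soft sets with constant value $\emptyset$, respectively $X$. Soft union, soft intersection $\sqcap$, complement $(F,A)^c$ and inclusion $\sqsubseteq$ are defined parameterwise. For $x\in X$, $x\in(F,A)$ means $x\in F(a)$ for all $a\in A$; $x\notin(F,A)$ means $x\notin F(a)$ for some $a\in A$; so $x\in(F,A)^c$ means $x\notin F(a)$ for all $a\in A$. A soft topology on $X$ is a family $T\subseteq SS(X)_A$ containing $0_A,1_A$ and closed under binary soft intersections and arbitrary soft unions; members of $T$ are soft open, their complements are soft closed. A soft neighbourhood of $x$ is a soft set $(F,A)$ such that $x\in(G,A)\sqsubseteq(F,A)$ for some $(G,A)\in T$; $\mathcal U_x$ is the collection of these. Write $x\approx y$ if $x\in(G,A)$ for each $(G,A)\in\mathcal U_y$ and $y\in(F,A)$ for each $(F,A)\in\mathcal U_x$. The space is soft $T_{0U}$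 if whenever $x\approx y$, for every $a\in A$ and $(F,A)\in T$: $x\in F(a)$ if and only if $y\in F(a)$. Soft $T_0$ reflection: $X_0$ is the set of equivalence classes of $\approx$ on $X$, $r_X:X\to X_0$ the canonical surjection, and $T_0$ is the soft topology on $X_0$ consisting of those $(F,A)\in SS(X_0)_A$ for which the soft set $a\mapsto r_X^{-1}(F(a))$ belongs to $T$; $(X_0,T_0,A)$ is the soft $T_0$ reflection of $(X,T,A)$. A soft topological space is soft $T_{1^k}$ if for all distinct points $x,y$ there are soft open sets $(F,A),(G,A)$ with $x\in(F,A)$, $y\in(F,A)^c$, $y\in(G,A)$, $x\in(G,A)^c$. $(X,T,A)$ is soft $T_{(0,1^k)}$ if $(X_0,T_0,A)$ is soft $T_{1^k}$. *)

theory Defs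
  imports "HOL-Library.FuncSet"
begin

text \<open>
  A soft set over \<open>X\<close> with parameter set \<open>A\<close> is an extensional function from \<open>A\<close> to the
  powerset of \<open>X\<close>; extensionality (the value \<open>undefined\<close> outside \<open>A\<close>) makes equality of
  soft sets coincide with equality of maps on \<open>A\<close>.  Both \<open>X\<close> and \<open>A\<close> are arbitrary sets,
  and the parameter set is never allowed to vary within one space.
\<close>

definition soft_sets :: "'x set \<Rightarrow> 'a set \<Rightarrow> ('a \<Rightarrow> 'x set) set" where
  "soft_sets X A = A \<rightarrow>\<^sub>E Pow X"

definition soft_empty :: "'a set \<Rightarrow> 'a \<Rightarrow> 'x set" where
  "soft_empty A = (\<lambda>a\<in>A. {})"

definition soft_full :: "'x set \<Rightarrow> 'a set \<Rightarrow> 'a \<Rightarrow> 'x set" where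
  "soft_full X A = (\<lambda>a\<in>A. X)"

definition soft_inter :: "'a set \<Rightarrow> ('a \<Rightarrow> 'x set) \<Rightarrow> ('a \<Rightarrow> 'x set) \<Rightarrow> 'a \<Rightarrow> 'x set" where
  "soft_inter A F G = (\<lambda>a\<in>A. F a \<inter> G a)"

definition soft_Union :: "'a set \<Rightarrow> ('a \<Rightarrow> 'x set) set \<Rightarrow> 'a \<Rightarrow> 'x set" where
  "soft_Union A S = (\<lambda>a\<in>A. \<Union>F\<in>S. F a)"

definition soft_compl :: "'x set \<Rightarrow> 'a set \<Rightarrow> ('a \<Rightarrow> 'x set) \<Rightarrow> 'a \<Rightarrow> 'x set" where
  "soft_compl X A F = (\<lambda>a\<in>A. X - F a)"

definition soft_subset :: "'a set \<Rightarrow> ('a \<Rightarrow> 'x set) \<Rightarrow> ('a \<Rightarrow> 'x set) \<Rightarrow> bool" where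
  "soft_subset A F G \<longleftrightarrow> (\<forall>a\<in>A. F a \<subseteq> G a)"

definition soft_mem :: "'a set \<Rightarrow> 'x \<Rightarrow> ('a \<Rightarrow> 'x set) \<Rightarrow> bool" where
  "soft_mem A x F \<longleftrightarrow> (\<forall>a\<in>A. x \<in> F a)"

definition soft_topology :: "'x set \<Rightarrow> 'a set \<Rightarrow> ('a \<Rightarrow> 'x set) set \<Rightarrow> bool" where
  "soft_topology X A T \<longleftrightarrow>
     T \<subseteq> soft_sets X A \<and>
     soft_empty A \<in> T \<and>
     soft_full X A \<in> T \<and>
     (\<forall>F\<in>T. \<forall>G\<in>T. soft_inter A F G \<in> T) \<and>
     (\<forall>S. S \<subseteq> T \<longrightarrow> soft_Union A S \<in> T)"

definition soft_closed :: "'x set \<Rightarrow> 'a set \<Rightarrow> ('a \<Rightarrow> 'x set) set \<Rightarrow> ('a \<Rightarrow> 'x set) \<Rightarrow> bool" where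
  "soft_closed X A T F \<longleftrightarrow> (\<exists>G\<in>T. F = soft_compl X A G)"

definition soft_nbhds ::
  "'x set \<Rightarrow> 'a set \<Rightarrow> ('a \<Rightarrow> 'x set) set \<Rightarrow> 'x \<Rightarrow> ('a \<Rightarrow> 'x set) set" where
  "soft_nbhds X A T x =
     {F \<in> soft_sets X A. \<exists>G\<in>T. soft_mem A x G \<and> soft_subset A G F}"

definition soft_indist ::
  "'x set \<Rightarrow> 'a set \<Rightarrow> ('a \<Rightarrow> 'x set) set \<Rightarrow> 'x \<Rightarrow> 'x \<Rightarrow> bool" where
  "soft_indist X A T x y \<longleftrightarrow>
     (\<forall>G\<in>soft_nbhds X A T y. soft_mem A x G) \<and>
     (\<forall>F\<in>soft_nbhds X A T x. soft_mem A y F)"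

definition soft_T0U :: "'x set \<Rightarrow> 'a set \<Rightarrow> ('a \<Rightarrow> 'x set) set \<Rightarrow> bool" where
  "soft_T0U X A T \<longleftrightarrow>
     (\<forall>x\<in>X. \<forall>y\<in>X. soft_indist X A T x y \<longrightarrow>
        (\<forall>a\<in>A. \<forall>F\<in>T. x \<in> F a \<longleftrightarrow> y \<in> F a))"

definition soft_indist_rel :: "'x set \<Rightarrow> 'a set \<Rightarrow> ('a \<Rightarrow> 'x set) set \<Rightarrow> ('x \<times> 'x) set" where
  "soft_indist_rel X A T = {(x, y). x \<in> X \<and> y \<in> X \<and> soft_indist X A T x y}"

definition T0_points :: "'x set \<Rightarrow> 'a set \<Rightarrow> ('a \<Rightarrow> 'x set) set \<Rightarrow> 'x set set" where
  "T0_points X A T = X // soft_indist_rel X A T"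

definition T0_proj :: "'x set \<Rightarrow> 'a set \<Rightarrow> ('a \<Rightarrow> 'x set) set \<Rightarrow> 'x \<Rightarrow> 'x set" where
  "T0_proj X A T = Equiv_Relations.proj (soft_indist_rel X A T)"

definition soft_preimage ::
  "'x set \<Rightarrow> 'a set \<Rightarrow> ('x \<Rightarrow> 'y) \<Rightarrow> ('a \<Rightarrow> 'y set) \<Rightarrow> 'a \<Rightarrow> 'x set" where
  "soft_preimage X A r F = (\<lambda>a\<in>A. {x \<in> X. r x \<in> F a})"

definition T0_opens :: "'x set \<Rightarrow> 'a set \<Rightarrow> ('a \<Rightarrow> 'x set) set \<Rightarrow> ('a \<Rightarrow> 'x set set) set" where
  "T0_opens X A T =
     {F \<in> soft_sets (T0_points X A T) A. soft_preimage X A (T0_proj X A T) F \<in> T}"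

definition soft_T1k :: "'x set \<Rightarrow> 'a set \<Rightarrow> ('a \<Rightarrow> 'x set) set \<Rightarrow> bool" where
  "soft_T1k X A T \<longleftrightarrow>
     (\<forall>x\<in>X. \<forall>y\<in>X. x \<noteq> y \<longrightarrow>
        (\<exists>F\<in>T. \<exists>G\<in>T.
           soft_mem A x F \<and> soft_mem A y (soft_compl X A F) \<and>
           soft_mem A y G \<and> soft_mem A x (soft_compl X A G)))"

definition soft_T01k :: "'x set \<Rightarrow> 'a set \<Rightarrow> ('a \<Rightarrow> 'x set) set \<Rightarrow> bool" where
  "soft_T01k X A T \<longleftrightarrow> soft_T1k (T0_points X A T) A (T0_opens X A T)"

definition soft_class ::
  "'x set \<Rightarrow> 'a set \<Rightarrow> ('a \<Rightarrow> 'x set) set \<Rightarrow> 'x \<Rightarrow> 'a \<Rightarrow> 'x set" where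
  "soft_class X A T x = (\<lambda>a\<in>A. {y \<in> X. soft_indist X A T y x})"

lemma equiv_soft_indist_rel:
  assumes "soft_topology X A T"
  shows "equiv X (soft_indist_rel X A T)"
proof -
  have T: "F \<in> soft_sets X A" if "F \<in> T" for F
    using assms that unfolding soft_topology_def by blast
  have nb: "F \<in> soft_nbhds X A T x" if "F \<in> T" "soft_mem A x F" for F x
    using that T by (auto simp: soft_nbhds_def soft_subset_def)
  have mono: "soft_mem A x F" if "soft_mem A x G" "soft_subset A G F" for x F G
    using that by (auto simp: soft_mem_def soft_subset_def)
  have iff: "soft_indist X A T x y \<longleftrightarrow> (\<forall>F\<in>T. soft_mem A x F \<longleftrightarrow> soft_mem A y F)" for x y
  proof
    show "\<forall>F\<in>T. soft_mem A x F \<longleftrightarrow> soft_mem A y F" if "soft_indist X A T x y"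
      using that nb unfolding soft_indist_def by blast
    show "soft_indist X A T x y" if "\<forall>F\<in>T. soft_mem A x F \<longleftrightarrow> soft_mem A y F"
      unfolding soft_indist_def soft_nbhds_def
    proof (intro conjI ballI; clarify)
      fix F G
      assume "G \<in> T" "soft_mem A y G" "soft_subset A G F"
      then show "soft_mem A x F" using that mono[of x G F] by simp
    next
      fix F G
      assume "G \<in> T" "soft_mem A x G" "soft_subset A G F"
      then show "soft_mem A y F" using that mono[of y G F] by simp
    qed
  qed
  show ?thesis
    by (rule equivI) (auto simp: soft_indist_rel_def iff refl_on_def sym_on_def trans_on_def)
qed

lemma soft_topology_T0_opens:
  assumes "soft_topology X A T"
  shows "soft_topology (T0_points X A T) A (T0_opens X A T)"
proof -
  let ?r = "T0_proj X A T" and ?Y = "T0_points X A T"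
  have r: "?r x \<in> ?Y" if "x \<in> X" for x
    using that by (simp add: T0_proj_def T0_points_def proj_preserves)
  have pe: "soft_preimage X A ?r (soft_empty A) = soft_empty A"
    by (rule ext) (simp add: soft_preimage_def soft_empty_def restrict_def)
  have pf: "soft_preimage X A ?r (soft_full ?Y A) = soft_full X A"
    using r by (intro ext) (auto simp: soft_preimage_def soft_full_def restrict_def)
  have pi: "soft_preimage X A ?r (soft_inter A F G) =
      soft_inter A (soft_preimage X A ?r F) (soft_preimage X A ?r G)" for F G
    by (rule ext) (auto simp: soft_preimage_def soft_inter_def restrict_def)
  have pu: "soft_preimage X A ?r (soft_Union A S) =
      soft_Union A (soft_preimage X A ?r ` S)" for S
    by (rule ext) (auto simp: soft_preimage_def soft_Union_def restrict_def)
  have un: "soft_Union A S \<in> T0_opens X A T" if S: "S \<subseteq> T0_opens X A T" for S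
  proof -
    have "soft_Union A S \<in> soft_sets ?Y A"
      using S unfolding soft_sets_def soft_Union_def
    proof (intro PiE_I)
      fix a
      assume "a \<in> A"
      then have "F a \<subseteq> ?Y" if "F \<in> S" for F
        using S that PiE_mem[of F A "\<lambda>_. Pow ?Y" a] by (auto simp: T0_opens_def soft_sets_def)
      with \<open>a \<in> A\<close> show "(\<lambda>a\<in>A. \<Union>F\<in>S. F a) a \<in> Pow ?Y"
        by (simp add: UN_least)
    qed simp
    moreover have "soft_preimage X A ?r ` S \<subseteq> T"
      using S by (auto simp: T0_opens_def)
    ultimately show ?thesis
      using assms pu[of S] unfolding T0_opens_def soft_topology_def by auto
  qed
  have i: "soft_inter A F G \<in> T0_opens X A T"
    if "F \<in> T0_opens X A T" "G \<in> T0_opens X A T" for F G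
  proof -
    have "soft_inter A F G \<in> soft_sets ?Y A"
      using that unfolding T0_opens_def soft_sets_def soft_inter_def
      by (intro PiE_I) (auto dest: PiE_mem)
    then show ?thesis
      using assms that pi[of F G] unfolding T0_opens_def soft_topology_def by auto
  qed
  have ef: "soft_empty A \<in> T0_opens X A T" "soft_full ?Y A \<in> T0_opens X A T"
    using assms pe pf unfolding T0_opens_def soft_topology_def
    by (auto simp: soft_sets_def soft_empty_def soft_full_def)
  show ?thesis
    unfolding soft_topology_def using un i ef by (auto simp: T0_opens_def)
qed

end

theory Submission
  imports Defs
begin

text \<open>
  In a soft \<open>T\<^sub>0\<^sub>U\<close> space every value \<open>F a\<close> of a soft open set is a union of classes of
  indistinguishable points.  Both equivalences rest on this saturation.

  Pulling back along the canonical surjection always takes soft open sets of the reflection to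
  soft open sets of the space.  Saturation makes every soft open set of the space the preimage of
  its own image, so that image is soft open in the reflection.  Hence a pair of points is
  separated in \<open>X\<close> exactly when the pair of their classes is separated in the reflection
  (\<open>excludes_T0_proj_iff\<close>); since distinct classes are the classes of distinguishable points, this
  is the equivalence of (a) and (b).

  For (b) and (c), the classical argument that \<open>T\<^sub>1\<close> means that points are closed is run with
  classes in place of points (\<open>soft_closed_soft_class_iff\<close>).  If every point outside \<open>[x]\<close> has
  a soft open set that misses \<open>x\<close> at every parameter, then each of these sets misses the whole
  class \<open>[x]\<close> by saturation, and their soft union is the complement of the class.  Conversely,
  the complement of the class of \<open>x\<close> contains, at every parameter, each point distinguishable
  from \<open>x\<close>, and contains \<open>x\<close> at none.
\<close>

text \<open>
  The separation conditions in (a) and (b) ask for this relation in both directions, and they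
  quantify over a symmetric relation between points; so it suffices to treat one direction.
\<close>

definition excludes ::
  "'x set \<Rightarrow> 'a set \<Rightarrow> ('a \<Rightarrow> 'x set) set \<Rightarrow> 'x \<Rightarrow> 'x \<Rightarrow> bool" where
  "excludes X A T x y \<longleftrightarrow> (\<exists>G\<in>T. soft_mem A x G \<and> soft_mem A y (soft_compl X A G))"

lemma excludes_iff:
  assumes "y \<in> X"
  shows "excludes X A T x y \<longleftrightarrow> (\<exists>G\<in>T. \<forall>a\<in>A. x \<in> G a \<and> y \<notin> G a)"
  using assms by (auto simp: excludes_def soft_mem_def soft_compl_def)

lemma soft_indist_sym: "soft_indist X A T x y \<longleftrightarrow> soft_indist X A T y x"
  by (auto simp: soft_indist_def)

lemma soft_open_subset:
  assumes "soft_topology X A T" "F \<in> T" "a \<in> A"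
  shows "F a \<subseteq> X"
  using assms by (auto simp: soft_topology_def soft_sets_def dest!: PiE_mem)

lemma T0_proj_eq_iff:
  assumes "soft_topology X A T" "x \<in> X" "y \<in> X"
  shows "T0_proj X A T x = T0_proj X A T y \<longleftrightarrow> soft_indist X A T x y"
  using proj_iff[OF equiv_soft_indist_rel[OF assms(1)], of x y] assms(2,3)
  by (simp add: T0_proj_def soft_indist_rel_def)

lemma T0_points_eq_image: "T0_points X A T = T0_proj X A T ` X"
  by (auto simp: T0_points_def T0_proj_def proj_def quotient_def)

text \<open>
  A soft open set is recovered from its image in the reflection because it is saturated: a point
  whose class meets \<open>F a\<close> is indistinguishable from a point of \<open>F a\<close>, so \<open>T\<^sub>0\<^sub>U\<close> puts it in \<open>F a\<close>.
\<close>

lemma soft_preimage_image_T0_proj: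
  assumes top: "soft_topology X A T" and T0U: "soft_T0U X A T" and F: "F \<in> T"
  shows "soft_preimage X A (T0_proj X A T) (\<lambda>a\<in>A. T0_proj X A T ` F a) = F"
proof
  fix a
  have "F a = undefined" if "a \<notin> A"
    using top F that by (auto simp: soft_topology_def soft_sets_def dest: PiE_arb)
  moreover have "x \<in> F a"
    if "a \<in> A" "x \<in> X" "y \<in> F a" "T0_proj X A T x = T0_proj X A T y" for x y
  proof -
    have "y \<in> X" using soft_open_subset[OF top F] that by blast
    then have "soft_indist X A T x y" using T0_proj_eq_iff[OF top] that by blast
    then show ?thesis using T0U F that \<open>y \<in> X\<close> by (auto simp: soft_T0U_def)
  qed
  ultimately show "soft_preimage X A (T0_proj X A T) (\<lambda>a\<in>A. T0_proj X A T ` F a) a = F a"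
    using soft_open_subset[OF top F, of a] by (auto simp: soft_preimage_def)
qed

lemma image_T0_proj_in_T0_opens:
  assumes "soft_topology X A T" "soft_T0U X A T" "F \<in> T"
  shows "(\<lambda>a\<in>A. T0_proj X A T ` F a) \<in> T0_opens X A T"
proof -
  have "T0_proj X A T ` F a \<subseteq> T0_points X A T" if "a \<in> A" for a
    unfolding T0_points_eq_image using soft_open_subset[OF assms(1,3) that] by (rule image_mono)
  then have "(\<lambda>a\<in>A. T0_proj X A T ` F a) \<in> soft_sets (T0_points X A T) A"
    by (simp add: soft_sets_def)
  then show ?thesis
    using soft_preimage_image_T0_proj[OF assms] assms(3) by (simp add: T0_opens_def)
qed

lemma excludes_T0_proj_iff:
  assumes top: "soft_topology X A T" and T0U: "soft_T0U X A T" and x: "x \<in> X" and y: "y \<in> X"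
  shows "excludes (T0_points X A T) A (T0_opens X A T) (T0_proj X A T x) (T0_proj X A T y)
    \<longleftrightarrow> excludes X A T x y"
proof -
  let ?r = "T0_proj X A T"
  have ry: "?r y \<in> T0_points X A T" using y by (simp add: T0_points_eq_image)
  show ?thesis unfolding excludes_iff[OF ry] excludes_iff[OF y]
  proof
    assume "\<exists>G\<in>T0_opens X A T. \<forall>a\<in>A. ?r x \<in> G a \<and> ?r y \<notin> G a"
    then obtain G where G: "G \<in> T0_opens X A T" "\<forall>a\<in>A. ?r x \<in> G a \<and> ?r y \<notin> G a" by blast
    then have "soft_preimage X A ?r G \<in> T" by (simp add: T0_opens_def)
    moreover have "\<forall>a\<in>A. x \<in> soft_preimage X A ?r G a \<and> y \<notin> soft_preimage X A ?r G a"
      using G x y by (simp add: soft_preimage_def)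
    ultimately show "\<exists>G\<in>T. \<forall>a\<in>A. x \<in> G a \<and> y \<notin> G a" by blast
  next
    assume "\<exists>G\<in>T. \<forall>a\<in>A. x \<in> G a \<and> y \<notin> G a"
    then obtain G where G: "G \<in> T" "\<forall>a\<in>A. x \<in> G a \<and> y \<notin> G a" by blast
    let ?I = "\<lambda>a\<in>A. ?r ` G a"
    have "?r y \<notin> ?I a" if "a \<in> A" for a
    proof
      assume "?r y \<in> ?I a"
      then have "y \<in> soft_preimage X A ?r ?I a"
        using y that by (simp add: soft_preimage_def)
      then show False using soft_preimage_image_T0_proj[OF top T0U G(1)] G(2) that by simp
    qed
    then have "\<forall>a\<in>A. ?r x \<in> ?I a \<and> ?r y \<notin> ?I a" using G(2) by simp
    then show "\<exists>G\<in>T0_opens X A T. \<forall>a\<in>A. ?r x \<in> G a \<and> ?r y \<notin> G a"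
      using image_T0_proj_in_T0_opens[OF top T0U G(1)] by blast
  qed
qed

lemma soft_T1k_iff_excludes:
  "soft_T1k X A T \<longleftrightarrow> (\<forall>x\<in>X. \<forall>y\<in>X. x \<noteq> y \<longrightarrow> excludes X A T x y)"
proof -
  have "soft_T1k X A T \<longleftrightarrow>
      (\<forall>x\<in>X. \<forall>y\<in>X. x \<noteq> y \<longrightarrow> excludes X A T x y \<and> excludes X A T y x)"
    unfolding soft_T1k_def excludes_def by (intro ball_cong imp_cong) auto
  then show ?thesis by auto
qed

lemma soft_T01k_iff_excludes:
  assumes "soft_topology X A T" "soft_T0U X A T"
  shows "soft_T01k X A T \<longleftrightarrow>
    (\<forall>x\<in>X. \<forall>y\<in>X. \<not> soft_indist X A T x y \<longrightarrow> excludes X A T x y)"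
proof -
  have ball: "(\<forall>p\<in>T0_points X A T. P p) \<longleftrightarrow> (\<forall>x\<in>X. P (T0_proj X A T x))" for P
    by (simp add: T0_points_eq_image)
  show ?thesis
    unfolding soft_T01k_def soft_T1k_iff_excludes ball
    using excludes_T0_proj_iff[OF assms] T0_proj_eq_iff[OF assms(1)] by simp
qed

text \<open>
  The equivalence of (b) and (c) at a single point.  To show that the class is closed, its
  complement is written as the soft union of all soft open sets that miss \<open>x\<close> at every parameter; taking all
  of them avoids choosing one for each point outside the class.
\<close>

lemma soft_closed_soft_class_iff:
  assumes top: "soft_topology X A T" and T0U: "soft_T0U X A T" and x: "x \<in> X"
  shows "soft_closed X A T (soft_class X A T x) \<longleftrightarrow>
    (\<forall>y\<in>X. \<not> soft_indist X A T y x \<longrightarrow> excludes X A T y x)"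
proof
  assume "soft_closed X A T (soft_class X A T x)"
  then obtain G where G: "G \<in> T" "soft_class X A T x = soft_compl X A G"
    by (auto simp: soft_closed_def)
  have eq: "{y \<in> X. soft_indist X A T y x} = X - G a" if "a \<in> A" for a
    using fun_cong[OF G(2), of a] that by (simp add: soft_class_def soft_compl_def)
  have "soft_indist X A T x x"
    by (auto simp: soft_indist_def soft_nbhds_def soft_mem_def soft_subset_def)
  then have "\<forall>a\<in>A. y \<in> G a \<and> x \<notin> G a" if "y \<in> X" "\<not> soft_indist X A T y x" for y
    using eq that x by blast
  then show "\<forall>y\<in>X. \<not> soft_indist X A T y x \<longrightarrow> excludes X A T y x"
    using G(1) excludes_iff[OF x] by blast
next
  assume ex: "\<forall>y\<in>X. \<not> soft_indist X A T y x \<longrightarrow> excludes X A T y x"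
  define S where "S = {G \<in> T. \<forall>a\<in>A. x \<notin> G a}"
  have "soft_Union A S \<in> T"
    using top by (auto simp: soft_topology_def S_def)
  moreover have "{y \<in> X. soft_indist X A T y x} = X - (\<Union>F\<in>S. F a)" if a: "a \<in> A" for a
  proof -
    have "y \<notin> F a" if "y \<in> X" "soft_indist X A T y x" "F \<in> S" for y F
      using T0U a x that by (auto simp: soft_T0U_def S_def)
    moreover have "\<exists>F\<in>S. y \<in> F a" if "y \<in> X" "\<not> soft_indist X A T y x" for y
    proof -
      have "excludes X A T y x" using ex that by blast
      then obtain G where "G \<in> T" "\<forall>a\<in>A. y \<in> G a \<and> x \<notin> G a"
        unfolding excludes_iff[OF x] by blast
      then show ?thesis using a by (auto simp: S_def)
    qed
    ultimately show ?thesis by blast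
  qed
  then have "soft_class X A T x = soft_compl X A (soft_Union A S)"
    unfolding soft_class_def soft_compl_def soft_Union_def by (intro restrict_ext) simp
  ultimately show "soft_closed X A T (soft_class X A T x)"
    by (auto simp: soft_closed_def)
qed

theorem proposition4p4:
  fixes X :: "'x set" and A :: "'a set" and T :: "('a \<Rightarrow> 'x set) set"
  assumes "soft_topology X A T"
    and "soft_T0U X A T"
  shows "(soft_T01k X A T \<longleftrightarrow>
           (\<forall>x\<in>X. \<forall>y\<in>X. \<not> soft_indist X A T x y \<longrightarrow>
              (\<exists>G\<in>T. \<exists>H\<in>T.
                 soft_mem A x G \<and> soft_mem A y H \<and>
                 soft_mem A x (soft_compl X A H) \<and> soft_mem A y (soft_compl X A G)))) \<and>
         ((\<forall>x\<in>X. \<forall>y\<in>X. \<not> soft_indist X A T x y \<longrightarrow>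
              (\<exists>G\<in>T. \<exists>H\<in>T.
                 soft_mem A x G \<and> soft_mem A y H \<and>
                 soft_mem A x (soft_compl X A H) \<and> soft_mem A y (soft_compl X A G))) \<longleftrightarrow>
           (\<forall>x\<in>X. soft_closed X A T (soft_class X A T x)))"
proof -
  let ?sep = "\<forall>x\<in>X. \<forall>y\<in>X. \<not> soft_indist X A T x y \<longrightarrow>
              (\<exists>G\<in>T. \<exists>H\<in>T.
                 soft_mem A x G \<and> soft_mem A y H \<and>
                 soft_mem A x (soft_compl X A H) \<and> soft_mem A y (soft_compl X A G))"
  have "?sep \<longleftrightarrow> (\<forall>x\<in>X. \<forall>y\<in>X. \<not> soft_indist X A T x y \<longrightarrow> excludes X A T x y)"
    (is "_ \<longleftrightarrow> ?ex")
  proof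
    show ?ex if ?sep
      using that unfolding excludes_def by meson
    show ?sep if ex: ?ex
    proof (intro ballI impI)
      fix x y
      assume "x \<in> X" "y \<in> X" "\<not> soft_indist X A T x y"
      then have "excludes X A T x y" "excludes X A T y x"
        using ex soft_indist_sym[of X A T x y] by simp_all
      then show "\<exists>G\<in>T. \<exists>H\<in>T. soft_mem A x G \<and> soft_mem A y H \<and>
          soft_mem A x (soft_compl X A H) \<and> soft_mem A y (soft_compl X A G)"
        unfolding excludes_def by blast
    qed
  qed
  moreover have "(\<forall>x\<in>X. soft_closed X A T (soft_class X A T x)) \<longleftrightarrow> ?ex"
    using soft_closed_soft_class_iff[OF assms] by blast
  ultimately show ?thesis
    using soft_T01k_iff_excludes[OF assms] by simp
qed

end
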